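(* Let $(M,\eta)$ be Minkowski spacetime, with $\eta$ of signature $(+,-,-,-)$. Let $F$ be an electromagnetic tensor field on $M$, i.e. a closed two-form. Let $x_0,x_1\in M$ with $x_1$ in the chronological future of $x_0$, and let $q/m\in\mathbb{R}$ be a charge-to-mass ratio. Then there exists at least one future-directed timelike curve connecting $x_0$ and $x_1$ which, parameterized with respect to proper time $s$, is a solution of the Lorentz force equation $$D_s\Big(\frac{\mathrm{d}x}{\mathrm{d}s}\Big)=\frac{q}{mc^2}\,\hat F(x)\Big[\frac{\mathrm{d}x}{\mathrm{d}s}\Big].$$
   Context: The constant $c>0$ is the speed of light. Minkowski spacetime is $M=\mathbb{R}^4$ with the flat metric $\eta=\mathrm{diag}(1,-1,-1,-1)$ and its standard time orientation. A tangent vector $v$ is timelike if $\eta(v,v)>0$; a curve is timelike if its tangent vector is so at every point. The chronological future of $x_0$ is the set of points that can be reached from $x_0$ by a future-directed timelike curve. The proper time $s$ of a timelike curve is the parameter for which $\eta(\mathrm{d}x/\mathrm{d}s,\mathrm{d}x/\mathrm{d}s)=1$. A curve connects $x_0$ and $x_1$ if it is defined on a compact interval, starts at $x_0$ and ends at $x_1$. $D_s$ denotes the covariant derivative along the curve with respect to the Levi-Civita connection of $\eta$ (in standard coordinates, the ordinary derivative with respect to $s$). The linear map $\hat F(x):T_xM\to T_xM$ is defined by $\eta[v,\hat F(x)[w]]=F(x)[v,w]$ for all $v,w\in T_xM$. *)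

theory Defs
  imports "HOL-Analysis.Analysis"
begin

text \<open>Every tangent space of Minkowski spacetime is identified with \<open>real ^ 4\<close> through the
  standard coordinates. The coordinate with index 1 is the time coordinate \<open>x\<^sup>0\<close> (a length,
  \<open>c\<close> times the time).\<close>

type_synonym spacetime = "real ^ 4"

definition minkowski :: "spacetime \<Rightarrow> spacetime \<Rightarrow> real" where
  "minkowski v w = v $ 1 * w $ 1 - v $ 2 * w $ 2 - v $ 3 * w $ 3 - v $ 4 * w $ 4"

definition timelike :: "spacetime \<Rightarrow> bool" where
  "timelike v \<longleftrightarrow> minkowski v v > 0"

text \<open>Only meaningful for causal vectors.\<close>

definition future_directed :: "spacetime \<Rightarrow> bool" where
  "future_directed v \<longleftrightarrow> v $ 1 > 0"

section \<open>Curves\<close>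

text \<open>A curve is a function on \<open>real\<close> of which only the restriction to \<open>{a..b}\<close> matters;
  the derivatives at the two endpoints are one-sided.\<close>

definition velocity :: "(real \<Rightarrow> spacetime) \<Rightarrow> real \<Rightarrow> real \<Rightarrow> real \<Rightarrow> spacetime" where
  "velocity \<gamma> a b t = vector_derivative \<gamma> (at t within {a..b})"

definition C1_curve :: "(real \<Rightarrow> spacetime) \<Rightarrow> real \<Rightarrow> real \<Rightarrow> bool" where
  "C1_curve \<gamma> a b \<longleftrightarrow> a < b \<and> \<gamma> differentiable_on {a..b} \<and> continuous_on {a..b} (velocity \<gamma> a b)"

definition future_timelike_curve :: "(real \<Rightarrow> spacetime) \<Rightarrow> real \<Rightarrow> real \<Rightarrow> bool" where
  "future_timelike_curve \<gamma> a b \<longleftrightarrow> C1_curve \<gamma> a b \<and>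
     (\<forall>t\<in>{a..b}. timelike (velocity \<gamma> a b t) \<and> future_directed (velocity \<gamma> a b t))"

definition connects :: "(real \<Rightarrow> spacetime) \<Rightarrow> real \<Rightarrow> real \<Rightarrow> spacetime \<Rightarrow> spacetime \<Rightarrow> bool" where
  "connects \<gamma> a b x y \<longleftrightarrow> \<gamma> a = x \<and> \<gamma> b = y"

definition chronological_future :: "spacetime \<Rightarrow> spacetime set" where
  "chronological_future x = {y. \<exists>\<gamma> a b. future_timelike_curve \<gamma> a b \<and> connects \<gamma> a b x y}"

definition proper_time_parameterized :: "(real \<Rightarrow> spacetime) \<Rightarrow> real \<Rightarrow> real \<Rightarrow> bool" where
  "proper_time_parameterized \<gamma> a b \<longleftrightarrow>
     (\<forall>s\<in>{a..b}. minkowski (velocity \<gamma> a b s) (velocity \<gamma> a b s) = 1)"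

section \<open>Electromagnetic fields\<close>

primrec Ck :: "nat \<Rightarrow> ('a::euclidean_space \<Rightarrow> real) \<Rightarrow> bool" where
  "Ck 0 f \<longleftrightarrow> continuous_on UNIV f"
| "Ck (Suc k) f \<longleftrightarrow> (\<forall>x. f differentiable at x) \<and> (\<forall>v. Ck k (\<lambda>x. frechet_derivative f (at x) v))"

definition smooth :: "('a::euclidean_space \<Rightarrow> real) \<Rightarrow> bool" where
  "smooth f \<longleftrightarrow> (\<forall>k. Ck k f)"

definition two_form :: "(spacetime \<Rightarrow> spacetime \<Rightarrow> spacetime \<Rightarrow> real) \<Rightarrow> bool" where
  "two_form F \<longleftrightarrow> (\<forall>x. bilinear (F x) \<and> (\<forall>v. F x v v = 0)) \<and> (\<forall>v w. smooth (\<lambda>x. F x v w))"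

text \<open>The invariant formula for the exterior derivative, evaluated on constant vector fields, whose
  brackets vanish.\<close>

definition exterior_derivative ::
  "(spacetime \<Rightarrow> spacetime \<Rightarrow> spacetime \<Rightarrow> real) \<Rightarrow> spacetime \<Rightarrow> spacetime \<Rightarrow> spacetime \<Rightarrow> spacetime \<Rightarrow> real"
where
  "exterior_derivative F x u v w =
     frechet_derivative (\<lambda>y. F y v w) (at x) u
   - frechet_derivative (\<lambda>y. F y u w) (at x) v
   + frechet_derivative (\<lambda>y. F y u v) (at x) w"

definition closed_two_form :: "(spacetime \<Rightarrow> spacetime \<Rightarrow> spacetime \<Rightarrow> real) \<Rightarrow> bool" where
  "closed_two_form F \<longleftrightarrow> two_form F \<and> (\<forall>x u v w. exterior_derivative F x u v w = 0)"

definition field_map ::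
  "(spacetime \<Rightarrow> spacetime \<Rightarrow> spacetime \<Rightarrow> real) \<Rightarrow> spacetime \<Rightarrow> spacetime \<Rightarrow> spacetime"
where
  "field_map F x = (THE L. linear L \<and> (\<forall>v w. minkowski v (L w) = F x v w))"

lemma minkowski_nondegenerate:
  assumes "\<And>v. minkowski v u = minkowski v u'"
  shows "u = u'"
  using assms[of "axis 1 1"] assms[of "axis 2 1"] assms[of "axis 3 1"] assms[of "axis 4 1"]
  by (simp add: minkowski_def axis_def vec_eq_iff forall_4)

lemma field_map:
  assumes "two_form F"
  shows "linear (field_map F x) \<and> (\<forall>v w. minkowski v (field_map F x w) = F x v w)"
proof -
  have bil: "bilinear (F x)"
    using assms by (simp add: two_form_def)
  define L where "L w = (\<chi> i. (if i = 1 then 1 else - 1) * F x (axis i 1) w)" for w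
  have lin: "linear L"
    by (rule linearI)
       (auto simp: L_def vec_eq_iff algebra_simps bilinear_radd[OF bil] bilinear_rmul[OF bil])
  have "minkowski v (L w) = F x v w" for v w
  proof -
    have "v = (\<Sum>i\<in>UNIV. v $ i *\<^sub>R axis i 1)"
      using basis_expansion[of v] by (simp add: scalar_mult_eq_scaleR)
    then have "F x v w = F x (\<Sum>i\<in>UNIV. v $ i *\<^sub>R axis i 1) w"
      by simp
    also have "\<dots> = (\<Sum>i\<in>UNIV. v $ i * F x (axis i 1) w)"
      by (simp add: sum_4 bilinear_ladd[OF bil] bilinear_lmul[OF bil])
    finally show ?thesis
      by (simp add: sum_4 minkowski_def L_def)
  qed
  with lin have *: "linear L \<and> (\<forall>v w. minkowski v (L w) = F x v w)"
    by blast
  have "L' = L" if "linear L' \<and> (\<forall>v w. minkowski v (L' w) = F x v w)" for L'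
    using that * by (intro ext minkowski_nondegenerate) simp
  from theI[of "\<lambda>L. linear L \<and> (\<forall>v w. minkowski v (L w) = F x v w)", OF * this]
  show ?thesis
    unfolding field_map_def .
qed

text \<open>In the standard coordinates the Christoffel symbols of the metric vanish, so the covariant
  derivative along \<open>\<gamma>\<close> is the ordinary one.\<close>

definition lorentz_force_solution ::
  "real \<Rightarrow> (spacetime \<Rightarrow> spacetime \<Rightarrow> spacetime \<Rightarrow> real) \<Rightarrow> (real \<Rightarrow> spacetime) \<Rightarrow> real \<Rightarrow> real \<Rightarrow> bool"
where
  "lorentz_force_solution k F \<gamma> a b \<longleftrightarrow>
     (\<forall>s\<in>{a..b}. (velocity \<gamma> a b has_vector_derivative
        k *\<^sub>R field_map F (\<gamma> s) (velocity \<gamma> a b s)) (at s within {a..b}))"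

end

theory Submission
  imports Defs
begin

text \<open>The proof is a shooting argument in coordinate time. A particle whose spatial momentum at \<open>x0\<close>
  is \<open>p\<close> moves slower than light, and over a bounded coordinate time the force changes its
  momentum by a bounded amount only. So for large \<open>\<bar>p\<bar>\<close> its trajectory is nearly a null straight line in the
  direction of \<open>p\<close>, which overshoots \<open>x1\<close>, since \<open>x1 - x0\<close> is timelike. The error with which the
  trajectory misses \<open>x1\<close> is thus a continuous function of \<open>p\<close> that points outward on a large
  sphere, and by Brouwer's theorem it has a zero. A final change of parameter to proper time yields
  the Lorentz force equation.\<close>

section \<open>Ordinary differential equations\<close>

text \<open>Most estimates along trajectories are put into this form: an auxiliary function is
  chosen whose derivative is visibly nonnegative. Derivatives are taken within the closed interval
  because solutions are only known there.\<close>

lemma nondecreasing_within: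
  fixes f :: "real \<Rightarrow> real"
  assumes "a \<le> b"
    and "\<And>x. x \<in> {a..b} \<Longrightarrow> (f has_real_derivative f' x) (at x within {a..b})"
    and "\<And>x. x \<in> {a..b} \<Longrightarrow> f' x \<ge> 0"
  shows "f a \<le> f b"
proof -
  have "\<exists>x\<in>{a..b}. f b - f a = f' x * (b - a)"
    by (rule mvt_very_simple[OF assms(1)])
       (use assms(2) in \<open>auto simp: has_field_derivative_def\<close>)
  then show ?thesis
    using assms(1,3) by (metis diff_ge_0_iff_ge mult_nonneg_nonneg)
qed

lemma constant_within:
  fixes f :: "real \<Rightarrow> real"
  assumes "a \<le> b"
    and d: "\<And>x. x \<in> {a..b} \<Longrightarrow> (f has_real_derivative 0) (at x within {a..b})"
  shows "f b = f a"
proof (rule antisym)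
  show "f a \<le> f b" using nondecreasing_within[OF assms] by simp
  have "- f a \<le> - f b"
    by (rule nondecreasing_within[OF \<open>a \<le> b\<close>, of _ "\<lambda>_. 0"]) (auto intro!: derivative_eq_intros d)
  then show "f b \<le> f a" by simp
qed

text \<open>Projecting onto the increment \<open>e = f b - f a\<close> makes the problem scalar: by
  Cauchy-Schwarz \<open>norm e * B * s - e \<bullet> f s\<close> is nondecreasing in
  \<open>s\<close>, and comparing the endpoints leaves a factor \<open>norm e\<close> to
  cancel.\<close>

lemma norm_diff_le_of_derivative:
  fixes f :: "real \<Rightarrow> 'a::real_inner"
  assumes "a \<le> b"
    and f: "\<And>s. s \<in> {a..b} \<Longrightarrow> (f has_vector_derivative f' s) (at s within {a..b})"
    and B: "\<And>s. s \<in> {a..b} \<Longrightarrow> norm (f' s) \<le> B"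
  shows "norm (f b - f a) \<le> B * (b - a)"
proof -
  define e where "e = f b - f a"
  have "norm e * B * a - e \<bullet> f a \<le> norm e * B * b - e \<bullet> f b"
  proof (rule nondecreasing_within[OF \<open>a \<le> b\<close>])
    fix s assume s: "s \<in> {a..b}"
    show "((\<lambda>s. norm e * B * s - e \<bullet> f s) has_real_derivative (norm e * B - e \<bullet> f' s)) (at s within {a..b})"
      unfolding has_real_derivative_iff_has_vector_derivative
      by (auto intro!: derivative_eq_intros f[OF s] bounded_linear.has_vector_derivative[OF bounded_linear_inner_right])
    have "e \<bullet> f' s \<le> norm e * norm (f' s)" by (rule norm_cauchy_schwarz)
    also have "\<dots> \<le> norm e * B" using B[OF s] by (intro mult_left_mono) auto
    finally show "norm e * B - e \<bullet> f' s \<ge> 0" by simp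
  qed
  then have "e \<bullet> e \<le> norm e * (B * (b - a))" by (simp add: e_def algebra_simps)
  then have "norm e * norm e \<le> norm e * (B * (b - a))"
    by (simp add: power2_norm_eq_inner[symmetric] power2_eq_square)
  moreover have "0 \<le> B"
    using order_trans[OF norm_ge_zero B[of a]] \<open>a \<le> b\<close> by simp
  ultimately show ?thesis
    using \<open>a \<le> b\<close> by (cases "norm e = 0") (auto simp: e_def)
qed

text \<open>Picard iteration contracts on all of \<open>{0..L}\<close> at once because the unknown is divided by
  \<open>exp (2 * K * t)\<close>.\<close>

lemma lipschitz_ode_exists:
  fixes G :: "'a::euclidean_space \<Rightarrow> 'a"
  assumes lip: "M-lipschitz_on UNIV G" and "0 < L"
  obtains Y where "Y 0 = y"
    and "\<And>t. t \<in> {0..L} \<Longrightarrow> (Y has_vector_derivative G (Y t)) (at t within {0..L})"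
proof -
  define K where "K = M + 1"
  have "M \<ge> 0" using lip by (rule lipschitz_on_nonneg)
  then have K: "K > 0" "M \<le> K" by (auto simp: K_def)
  have contG: "continuous_on UNIV G" using lip by (rule lipschitz_on_continuous_on)
  \<comment> \<open>Here \<open>h\<close> is the weighted unknown: the solution sought is
    \<open>exp (2 * K * t) *\<^sub>R h t\<close>, and a fixed point of \<open>I\<close> on
    \<open>{0..L}\<close> is the integral equation for it.\<close>
  define E where "E h = (\<lambda>s. G (exp (2 * K * s) *\<^sub>R apply_bcontfun h s))" for h :: "real \<Rightarrow>\<^sub>C 'a"
  define I where "I h t = exp (-2 * K * t) *\<^sub>R (y + integral {0..t} (E h))" for h t
  have contE: "continuous_on S (E h)" for h S
    unfolding E_def
    by (rule continuous_on_compose2[OF contG]) (auto intro!: continuous_intros)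
  have contI: "continuous_on (cbox 0 L) (I h)" for h
    unfolding I_def
    by (auto intro!: continuous_intros indefinite_integral_continuous_1 integrable_continuous_real contE)
  \<comment> \<open>Banach's theorem is applied in the complete space of bounded continuous
    functions on all of \<open>real\<close>, so \<open>clamp\<close> extends \<open>I h\<close> from
    \<open>{0..L}\<close> by its endpoint values.\<close>
  have "\<exists>g. \<forall>x. apply_bcontfun g x = I h (clamp 0 L x)" for h
    using continuous_on_cbox_bcontfunE[OF contI[of h]] by metis
  then obtain T where T: "\<And>h x. apply_bcontfun (T h) x = I h (clamp 0 L x)"
    by metis
  \<comment> \<open>The factor 1/2 comes from the weight: the integral of
    \<open>K * exp (2 * K * s)\<close> over \<open>{0..t}\<close> is at most half of
    \<open>exp (2 * K * t)\<close>, and the factor \<open>exp (-2 * K * t)\<close> in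
    \<open>I\<close> cancels that exponential.\<close>
  have "dist (T g) (T h) \<le> 1/2 * dist g h" for g h
  proof (rule dist_bound)
    fix x
    define t where "t = clamp 0 L x"
    have t: "t \<in> {0..L}" unfolding t_def using clamp_in_interval[of 0 L x] \<open>0 < L\<close> by auto
    have "norm (integral {0..t} (E g) - integral {0..t} (E h))
        = norm (integral {0..t} (\<lambda>s. E g s - E h s))"
      by (subst integral_diff) (auto intro: integrable_continuous_real contE)
    also have "\<dots> \<le> integral {0..t} (\<lambda>s. K * dist g h * exp (2 * K * s))"
    proof (rule integral_norm_bound_integral)
      fix s
      have "norm (E g s - E h s) \<le> M * norm (exp (2 * K * s) *\<^sub>R g s - exp (2 * K * s) *\<^sub>R h s)"
        unfolding E_def using lipschitz_onD[OF lip] by (simp add: dist_norm)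
      also have "\<dots> = M * (exp (2 * K * s) * dist (g s) (h s))"
        by (simp add: dist_norm flip: scaleR_diff_right)
      also have "\<dots> \<le> K * (exp (2 * K * s) * dist g h)"
        using K \<open>M \<ge> 0\<close> by (intro mult_mono dist_bounded) auto
      finally show "norm (E g s - E h s) \<le> K * dist g h * exp (2 * K * s)" by (simp add: mult_ac)
    qed (auto intro!: integrable_continuous_real contE continuous_intros)
    also have "\<dots> = dist g h / 2 * (exp (2 * K * t) - 1)"
    proof -
      have "((\<lambda>s. K * dist g h * exp (2 * K * s)) has_integral
          (dist g h / 2 * exp (2 * K * t) - dist g h / 2 * exp (2*K*0))) {0..t}"
        using t K by (intro fundamental_theorem_of_calculus)
          (auto intro!: derivative_eq_intros simp flip: has_real_derivative_iff_has_vector_derivative)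
      then show ?thesis by (subst integral_unique) (auto simp: right_diff_distrib)
    qed
    also have "\<dots> \<le> dist g h / 2 * exp (2 * K * t)"
      by (intro mult_left_mono) auto
    finally have *: "norm (integral {0..t} (E g) - integral {0..t} (E h)) \<le> dist g h / 2 * exp (2 * K * t)" .
    have "dist (T g x) (T h x)
        = exp (-2 * K * t) * norm (integral {0..t} (E g) - integral {0..t} (E h))"
      unfolding T t_def[symmetric] I_def dist_norm by (simp flip: scaleR_diff_right)
    also have "\<dots> \<le> exp (-2 * K * t) * (dist g h / 2 * exp (2 * K * t))"
      using * by (intro mult_left_mono) auto
    also have "\<dots> = 1/2 * dist g h" by (simp add: exp_minus field_simps)
    finally show "dist (T g x) (T h x) \<le> 1/2 * dist g h" .
  qed
  then obtain h where h: "T h = h"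
    using banach_fix_type[of "1/2" T] by auto
  define Y where "Y t = y + integral {0..t} (E h)" for t
  have hY: "h t = exp (-2 * K * t) *\<^sub>R Y t" if "t \<in> {0..L}" for t
    using T[of h t] that by (simp add: h I_def Y_def)
  show ?thesis
  proof
    show "Y 0 = y" by (simp add: Y_def)
    fix t assume t: "t \<in> {0..L}"
    have "(Y has_vector_derivative E h t) (at t within {0..L})"
      unfolding Y_def
      using integral_has_vector_derivative[OF contE t, of h]
      by (auto intro!: derivative_eq_intros)
    also have "E h t = G (Y t)"
      unfolding E_def hY[OF t] by (simp flip: exp_add)
    finally show "(Y has_vector_derivative G (Y t)) (at t within {0..L})" .
  qed
qed

text \<open>Gronwall's argument: the squared distance of two solutions grows at most at the rate
  \<open>2 * M\<close>, so multiplied by \<open>exp (-2 * M * s)\<close> it cannot increase. The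
  function \<open>g\<close> is its negative, to suit \<open>nondecreasing_within\<close>.\<close>

lemma lipschitz_ode_dependence:
  fixes G :: "'a::real_inner \<Rightarrow> 'a"
  assumes lip: "M-lipschitz_on UNIV G"
    and Y: "\<And>s. s \<in> {0..t} \<Longrightarrow> (Y has_vector_derivative G (Y s)) (at s within {0..t})"
    and Z: "\<And>s. s \<in> {0..t} \<Longrightarrow> (Z has_vector_derivative G (Z s)) (at s within {0..t})"
    and "0 \<le> t"
  shows "norm (Y t - Z t) \<le> exp (M * t) * norm (Y 0 - Z 0)"
proof -
  define D where "D s = Y s - Z s" for s
  define g where "g s = - (exp (-2 * M * s) * (D s \<bullet> D s))" for s
  define g' where "g' s = exp (-2 * M * s) * (2*M*(D s \<bullet> D s) - 2 * (D s \<bullet> (G (Y s) - G (Z s))))" for s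
  have "g 0 \<le> g t"
  proof (rule nondecreasing_within[OF \<open>0 \<le> t\<close>])
    fix s assume s: "s \<in> {0..t}"
    have "(D has_vector_derivative (G (Y s) - G (Z s))) (at s within {0..t})"
      unfolding D_def by (intro has_vector_derivative_diff Y Z s)
    then have "((\<lambda>s. D s \<bullet> D s) has_vector_derivative
        (D s \<bullet> (G (Y s) - G (Z s)) + (G (Y s) - G (Z s)) \<bullet> D s)) (at s within {0..t})"
      by (intro bounded_bilinear.has_vector_derivative[OF bounded_bilinear_inner])
    then have "((\<lambda>s. D s \<bullet> D s) has_real_derivative
        2 * (D s \<bullet> (G (Y s) - G (Z s)))) (at s within {0..t})"
      by (simp add: has_real_derivative_iff_has_vector_derivative inner_commute)
    then show "(g has_real_derivative g' s) (at s within {0..t})"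
      unfolding g_def g'_def by (auto intro!: derivative_eq_intros simp: algebra_simps)
    have "D s \<bullet> (G (Y s) - G (Z s)) \<le> norm (D s) * norm (G (Y s) - G (Z s))"
      by (rule norm_cauchy_schwarz)
    also have "\<dots> \<le> norm (D s) * (M * norm (D s))"
      using lipschitz_onD[OF lip, of "Y s" "Z s"] by (intro mult_left_mono) (auto simp: D_def dist_norm)
    also have "\<dots> = M * (D s \<bullet> D s)"
      by (simp add: power2_norm_eq_inner[symmetric] power2_eq_square)
    finally show "g' s \<ge> 0" by (simp add: g'_def)
  qed
  then have "exp (-2 * M * t) * (norm (D t))\<^sup>2 \<le> (norm (D 0))\<^sup>2"
    by (simp add: g_def power2_norm_eq_inner)
  then have "(norm (D t))\<^sup>2 \<le> exp (2 * M * t) * (norm (D 0))\<^sup>2"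
    by (simp add: exp_minus field_simps)
  also have "\<dots> = (exp (M*t) * norm (D 0))\<^sup>2"
    by (simp add: power_mult_distrib exp_double[symmetric] mult_ac)
  finally show ?thesis
    unfolding D_def by (rule power2_le_imp_le) auto
qed

section \<open>Kinematics\<close>

text \<open>The spatial part stays inside \<open>spacetime\<close>, with time component 0, so that
  momenta, positions and the unknown of the shooting problem share one type.\<close>

definition spatial :: "spacetime \<Rightarrow> spacetime" where
  "spatial w = w - (w $ 1) *\<^sub>R axis 1 1"

lemma spatial_nth [simp]:
  "spatial w $ 1 = 0" "spatial w $ 2 = w $ 2" "spatial w $ 3 = w $ 3" "spatial w $ 4 = w $ 4"
  by (simp_all add: spatial_def axis_def)

lemma inner_spacetime: "v \<bullet> w = v $ 1 * w $ 1 + v $ 2 * w $ 2 + v $ 3 * w $ 3 + v $ 4 * w $ 4"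
  for v w :: spacetime
  by (simp add: inner_vec_def sum_4)

lemma linear_spatial: "linear spatial"
  by (rule linearI) (simp_all add: spatial_def algebra_simps)

lemma bounded_linear_spatial: "bounded_linear spatial"
  using linear_spatial by (simp add: linear_conv_bounded_linear)

lemma spatial_add: "spatial (v + w) = spatial v + spatial w"
  and spatial_diff: "spatial (v - w) = spatial v - spatial w"
  and spatial_scaleR: "spatial (r *\<^sub>R w) = r *\<^sub>R spatial w"
  and spatial_axis: "spatial (axis 1 1) = 0"
  and spatial_spatial [simp]: "spatial (spatial w) = spatial w"
  by (simp_all add: spatial_def axis_def algebra_simps)

lemma norm_spatial: "(norm w)\<^sup>2 = (w $ 1)\<^sup>2 + (norm (spatial w))\<^sup>2"
  unfolding power2_norm_eq_inner by (simp add: inner_spacetime power2_eq_square)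

lemma norm_spatial_le: "norm (spatial w) \<le> norm w"
  by (rule power2_le_imp_le) (simp_all add: norm_spatial[of w])

lemma spatial_inner: "spatial v \<bullet> w = spatial v \<bullet> spatial w"
  by (simp add: inner_spacetime)

lemma minkowski_spatial: "minkowski v w = v $ 1 * w $ 1 - spatial v \<bullet> spatial w"
  by (simp add: minkowski_def inner_spacetime)

text \<open>This is \<open>w $ 1\<close> only if \<open>w\<close> lies on the future mass shell \<open>minkowski w w = 1\<close>.\<close>

definition energy :: "spacetime \<Rightarrow> real" where
  "energy w = norm (1::real, spatial w)"

lemma energy_eq: "energy w = sqrt (1 + spatial w \<bullet> spatial w)"
  by (simp add: energy_def norm_Pair power2_norm_eq_inner)

lemma energy_ge_1: "energy w \<ge> 1"
  by (simp add: energy_eq)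

lemma energy_pos: "energy w > 0"
  using energy_ge_1[of w] by linarith

lemma norm_spatial_le_energy: "norm (spatial w) \<le> energy w"
  unfolding energy_def by (rule norm_snd_le)

lemma energy_le: "energy w \<le> 1 + norm (spatial w)"
  unfolding energy_def using norm_Pair_le[of "1::real" "spatial w"] by simp

text \<open>This is the reverse triangle inequality for the vectors \<open>(1, spatial w)\<close>,
  and the reason for writing the energy as a norm.\<close>

lemma energy_lipschitz: "\<bar>energy w - energy u\<bar> \<le> norm (w - u)"
proof -
  have "\<bar>energy w - energy u\<bar> \<le> norm ((1::real, spatial w) - (1, spatial u))"
    unfolding energy_def by (rule norm_triangle_ineq3)
  also have "\<dots> = norm (spatial (w - u))" by (simp add: spatial_diff)
  finally show ?thesis using norm_spatial_le order_trans by blast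
qed

text \<open>The coordinate velocity \<open>dx/dx\<^sup>0\<close> of a particle with spatial momentum \<open>spatial w\<close>; unlike
  \<open>w\<close> itself it is bounded and globally Lipschitz.\<close>

definition direction :: "spacetime \<Rightarrow> spacetime" where
  "direction w = axis 1 1 + spatial w /\<^sub>R energy w"

lemma direction_nth_1 [simp]: "direction w $ 1 = 1"
  by (simp add: direction_def)

lemma spatial_direction: "spatial (direction w) = spatial w /\<^sub>R energy w"
  by (simp add: direction_def spatial_add spatial_scaleR spatial_axis)

lemma norm_direction_le: "norm (direction w) \<le> 2"
proof -
  have "norm (spatial w /\<^sub>R energy w) \<le> 1"
    using energy_pos[of w] norm_spatial_le_energy[of w] by (simp add: field_simps)
  then show ?thesis
    unfolding direction_def using norm_triangle_ineq[of "axis 1 1 :: spacetime" "spatial w /\<^sub>R energy w"]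
    by simp
qed

text \<open>The difference of the two quotients splits into a change of the numerator and a change
  of the denominator. Each costs at most \<open>norm (w - u)\<close>, because the energy is at least
  1 and dominates the spatial momentum.\<close>

lemma direction_lipschitz: "norm (direction w - direction u) \<le> 2 * norm (w - u)"
proof -
  have e: "energy w > 0" "energy u > 0" "energy w \<ge> 1" by (rule energy_pos energy_ge_1)+
  have "direction w - direction u =
      spatial (w - u) /\<^sub>R energy w + ((energy u - energy w) / energy w) *\<^sub>R (spatial u /\<^sub>R energy u)"
  proof -
    have "(energy u - energy w) / energy w * inverse (energy u) = inverse (energy w) - inverse (energy u)"
      using e by (simp add: field_simps)
    then show ?thesis
      by (simp add: direction_def spatial_diff scaleR_right_diff_distrib scaleR_left_diff_distrib)
  qed
  also have "norm \<dots> \<le> norm (spatial (w - u) /\<^sub>R energy w)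
      + norm (((energy u - energy w) / energy w) *\<^sub>R (spatial u /\<^sub>R energy u))"
    by (rule norm_triangle_ineq)
  also have "norm (spatial (w - u) /\<^sub>R energy w) \<le> norm (w - u)"
  proof -
    have "norm (spatial (w - u) /\<^sub>R energy w) = norm (spatial (w - u)) / energy w"
      using e by (simp add: divide_inverse)
    also have "\<dots> \<le> norm (spatial (w - u)) / 1"
      using e by (intro divide_left_mono) auto
    finally show ?thesis using norm_spatial_le[of "w - u"] by simp
  qed
  also have "norm (((energy u - energy w) / energy w) *\<^sub>R (spatial u /\<^sub>R energy u)) \<le> norm (w - u)"
  proof -
    have "norm (((energy u - energy w) / energy w) *\<^sub>R (spatial u /\<^sub>R energy u))
        = (\<bar>energy u - energy w\<bar> / energy w) * (norm (spatial u) / energy u)"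
      using e by (simp add: abs_mult divide_inverse)
    also have "\<dots> \<le> (norm (w - u) / 1) * 1"
    proof (rule mult_mono)
      show "\<bar>energy u - energy w\<bar> / energy w \<le> norm (w - u) / 1"
        using e energy_lipschitz[of u w] by (intro frac_le) (auto simp: norm_minus_commute)
      show "norm (spatial u) / energy u \<le> 1"
        using e norm_spatial_le_energy[of u] by simp
    qed (use e in auto)
    finally show ?thesis by simp
  qed
  finally show ?thesis by simp
qed

text \<open>Let \<open>e\<close> be the unit vector along the spatial displacement. Along a
  future-directed timelike curve the time coordinate grows faster than the component along
  \<open>e\<close>, so their difference \<open>f\<close> strictly increases.\<close>

lemma chronological_future_imp:
  assumes "x1 \<in> chronological_future x0"
  shows "norm (spatial (x1 - x0)) < (x1 - x0) $ 1"
proof -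
  obtain \<gamma> a b where \<gamma>: "future_timelike_curve \<gamma> a b" "connects \<gamma> a b x0 x1"
    using assms by (auto simp: chronological_future_def)
  define v where "v = velocity \<gamma> a b"
  have ab: "a < b" and d: "\<gamma> differentiable_on {a..b}"
    and v: "\<And>t. t \<in> {a..b} \<Longrightarrow> minkowski (v t) (v t) > 0 \<and> v t $ 1 > 0"
    using \<gamma>(1) by (auto simp: future_timelike_curve_def C1_curve_def timelike_def future_directed_def v_def)
  have der: "(\<gamma> has_vector_derivative v t) (at t within {a..b})" if "t \<in> {a..b}" for t
    using d that unfolding v_def velocity_def
    by (simp add: differentiable_on_def vector_derivative_works)
  have less: "norm (spatial (v t)) < v t $ 1" if "t \<in> {a..b}" for t
  proof (rule power_less_imp_less_base)
    show "(norm (spatial (v t)))\<^sup>2 < (v t $ 1)\<^sup>2"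
      using v[OF that] unfolding power2_norm_eq_inner by (simp add: minkowski_spatial power2_eq_square)
    show "0 \<le> v t $ 1" using v[OF that] by simp
  qed
  define D where "D = spatial (x1 - x0)"
  \<comment> \<open>For \<open>D = 0\<close> this gives \<open>e = 0\<close>, which still satisfies
    the three properties below.\<close>
  define e where "e = D /\<^sub>R norm D"
  have e: "norm e \<le> 1" "spatial e = e" "e \<bullet> (x1 - x0) = norm D"
  proof -
    show "norm e \<le> 1" by (cases "D = 0") (simp_all add: e_def)
    show "spatial e = e" by (simp add: e_def D_def spatial_scaleR)
    have "D \<bullet> (x1 - x0) = norm D * norm D"
      using spatial_inner[of "x1 - x0" "x1 - x0"]
      by (simp add: D_def power2_norm_eq_inner[symmetric] power2_eq_square)
    then show "e \<bullet> (x1 - x0) = norm D" by (cases "D = 0") (simp_all add: e_def)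
  qed
  define f where "f t = \<gamma> t $ 1 - e \<bullet> \<gamma> t" for t
  have f: "(f has_real_derivative (v t $ 1 - e \<bullet> v t)) (at t within {a..b})" if "t \<in> {a..b}" for t
    unfolding f_def has_real_derivative_iff_has_vector_derivative
    by (auto intro!: derivative_eq_intros der[OF that]
        bounded_linear.has_vector_derivative[OF bounded_linear_inner_right]
        bounded_linear.has_vector_derivative[OF bounded_linear_vec_nth])
  have pos: "v t $ 1 - e \<bullet> v t > 0" if "t \<in> {a..b}" for t
  proof -
    have "e \<bullet> v t = e \<bullet> spatial (v t)" using spatial_inner[of e "v t"] e(2) by simp
    also have "\<dots> \<le> norm e * norm (spatial (v t))" by (rule norm_cauchy_schwarz)
    also have "\<dots> \<le> 1 * norm (spatial (v t))" using e(1) by (intro mult_right_mono) auto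
    also have "\<dots> < v t $ 1" using less[OF that] by simp
    finally show ?thesis by simp
  qed
  have "\<exists>t\<in>{a<..<b}. f b - f a = (v t $ 1 - e \<bullet> v t) * (b - a)"
    by (rule mvt_simple[OF ab]) (use f in \<open>auto simp: has_field_derivative_def\<close>)
  then have "f b - f a > 0" using pos ab by force
  then show ?thesis
    using \<gamma>(2) e(3) by (simp add: f_def connects_def D_def inner_diff_right)
qed

section \<open>Lipschitz bounds for the field\<close>

text \<open>The partial derivatives are differentiable, hence continuous and bounded on the compact
  set; convexity then allows the mean value inequality.\<close>

lemma smooth_lipschitz_on_compact:
  fixes f :: "'a::euclidean_space \<Rightarrow> real"
  assumes f: "smooth f" and K: "compact K" "convex K"
  obtains B where "B-lipschitz_on K f"
proof -
  have "Ck 2 f" using f by (simp add: smooth_def)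
  then have diff: "\<And>x. f differentiable at x"
    and Ck1: "\<And>v. Ck 1 (\<lambda>x. frechet_derivative f (at x) v)"
    by (auto simp: numeral_2_eq_2)
  have "continuous_on K (\<lambda>x. frechet_derivative f (at x) v)" for v
  proof -
    have "\<And>x. (\<lambda>x. frechet_derivative f (at x) v) differentiable at x"
      using Ck1[of v] by simp
    then show ?thesis
      by (intro continuous_at_imp_continuous_on ballI differentiable_imp_continuous_within)
  qed
  then have "bounded ((\<lambda>x. frechet_derivative f (at x) v) ` K)" for v
    by (intro compact_imp_bounded compact_continuous_image K)
  then have "\<exists>b. \<forall>x\<in>K. \<bar>frechet_derivative f (at x) v\<bar> \<le> b" for v
    by (auto simp: bounded_iff)
  then obtain b where b: "\<And>v x. x \<in> K \<Longrightarrow> \<bar>frechet_derivative f (at x) v\<bar> \<le> b v"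
    by metis
  \<comment> \<open>The absolute value keeps \<open>B\<close> nonnegative even for empty
    \<open>K\<close>, where nothing restricts the sign of \<open>b\<close>.\<close>
  define B where "B = \<bar>\<Sum>i\<in>Basis. b i\<bar>"
  have d: "(f has_derivative frechet_derivative f (at x)) (at x)" for x
    using diff frechet_derivative_works by blast
  have on: "onorm (frechet_derivative f (at x)) \<le> B" if "x \<in> K" for x
  proof -
    have "bounded_linear (frechet_derivative f (at x))"
      using d has_derivative_bounded_linear by blast
    then have "onorm (frechet_derivative f (at x)) \<le> (\<Sum>i\<in>Basis. norm (frechet_derivative f (at x) i))"
      by (rule onorm_componentwise)
    also have "\<dots> \<le> (\<Sum>i\<in>Basis. b i)"
      using b[OF that] by (intro sum_mono) auto
    finally show ?thesis by (simp add: B_def)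
  qed
  show ?thesis
  proof
    show "B-lipschitz_on K f"
    proof (rule lipschitz_onI)
      fix x y assume "x \<in> K" "y \<in> K"
      then show "dist (f x) (f y) \<le> B * dist x y"
        unfolding dist_norm
        by (intro differentiable_bound[OF K(2), where f' = "\<lambda>z. frechet_derivative f (at z)"]
            on has_derivative_at_withinI[OF d])
    qed (simp add: B_def)
  qed
qed

lemma norm_linear_le:
  fixes L :: "'a::euclidean_space \<Rightarrow> 'b::real_normed_vector"
  assumes "linear L"
  shows "norm (L v) \<le> (\<Sum>j\<in>Basis. norm (L j)) * norm v"
proof -
  have bl: "bounded_linear L" using assms by (simp add: linear_conv_bounded_linear)
  have "norm (L v) \<le> onorm L * norm v" by (rule onorm[OF bl])
  also have "\<dots> \<le> (\<Sum>j\<in>Basis. norm (L j)) * norm v"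
    by (intro mult_right_mono onorm_componentwise[OF bl]) auto
  finally show ?thesis .
qed

lemma field_map_nth:
  assumes "two_form F"
  shows "field_map F x w $ i = (if i = 1 then 1 else - 1) * F x (axis i 1) w"
proof -
  have "minkowski (axis i 1) (field_map F x w) = F x (axis i 1) w"
    using field_map[OF assms] by blast
  then show ?thesis
    using exhaust_4[of i] by (auto simp: minkowski_def axis_def)
qed

text \<open>By linearity in \<open>v\<close> it suffices to bound, and to estimate the variation in
  \<open>x\<close> of, the values at the finitely many basis vectors. For a fixed argument the
  components are smooth functions of \<open>x\<close>, so \<open>smooth_lipschitz_on_compact\<close>
  applies to each.\<close>

lemma field_map_bounds:
  assumes F: "two_form F" and K: "compact K" "convex K"
  obtains B where "B \<ge> 0"
    and "\<And>x v. x \<in> K \<Longrightarrow> norm (field_map F x v) \<le> B * norm v"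
    and "\<And>x y v. x \<in> K \<Longrightarrow> y \<in> K \<Longrightarrow>
           norm (field_map F x v - field_map F y v) \<le> B * norm (x - y) * norm v"
proof -
  have lin: "linear (field_map F x)" for x using field_map[OF F] by blast
  have "\<exists>b. b-lipschitz_on K (\<lambda>x. field_map F x w)" for w
  proof -
    have "\<exists>b. b-lipschitz_on K (\<lambda>x. F x (axis i 1) w)" for i
    proof -
      have "smooth (\<lambda>x. F x (axis i 1) w)" using F by (simp add: two_form_def)
      then show ?thesis by (rule smooth_lipschitz_on_compact[OF _ K]) blast
    qed
    then obtain b where b: "\<And>i. (b i)-lipschitz_on K (\<lambda>x. F x (axis i 1) w)" by metis
    have "(\<Sum>i\<in>UNIV. b i)-lipschitz_on K (\<lambda>x. field_map F x w)"
    proof (rule lipschitz_onI)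
      fix x y assume xy: "x \<in> K" "y \<in> K"
      have "norm (field_map F x w - field_map F y w)
          \<le> (\<Sum>i\<in>UNIV. \<bar>(field_map F x w - field_map F y w) $ i\<bar>)"
        by (rule norm_le_l1_cart)
      also have "\<dots> \<le> (\<Sum>i\<in>UNIV. b i * dist x y)"
        using lipschitz_onD[OF b xy]
        by (intro sum_mono) (auto simp: field_map_nth[OF F] dist_real_def abs_minus_commute)
      finally show "dist (field_map F x w) (field_map F y w) \<le> (\<Sum>i\<in>UNIV. b i) * dist x y"
        by (simp add: dist_norm sum_distrib_right)
    qed (intro sum_nonneg lipschitz_on_nonneg[OF b])
    then show ?thesis by blast
  qed
  then obtain b where b: "\<And>w. (b w)-lipschitz_on K (\<lambda>x. field_map F x w)" by metis
  have "\<exists>c. \<forall>x\<in>K. norm (field_map F x w) \<le> c" for w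
  proof -
    have "bounded ((\<lambda>x. field_map F x w) ` K)"
      by (intro compact_imp_bounded compact_continuous_image K lipschitz_on_continuous_on[OF b])
    then show ?thesis by (auto simp: bounded_iff)
  qed
  then obtain c where c: "\<And>w x. x \<in> K \<Longrightarrow> norm (field_map F x w) \<le> c w" by metis
  define B where "B = (\<Sum>j\<in>Basis. b j) + \<bar>\<Sum>j\<in>Basis. c j\<bar>"
  have b0: "(\<Sum>j\<in>Basis. b j) \<ge> 0" by (intro sum_nonneg lipschitz_on_nonneg[OF b])
  show ?thesis
  proof
    show "B \<ge> 0" using b0 by (simp add: B_def)
    fix x v assume x: "x \<in> K"
    have "norm (field_map F x v) \<le> (\<Sum>j\<in>Basis. norm (field_map F x j)) * norm v"
      by (rule norm_linear_le[OF lin])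
    also have "\<dots> \<le> (\<Sum>j\<in>Basis. c j) * norm v"
      by (intro mult_right_mono sum_mono c x) auto
    also have "\<dots> \<le> B * norm v"
      using b0 by (intro mult_right_mono) (auto simp: B_def)
    finally show "norm (field_map F x v) \<le> B * norm v" .
    fix y assume y: "y \<in> K"
    have "norm (field_map F x v - field_map F y v)
        \<le> (\<Sum>j\<in>Basis. norm (field_map F x j - field_map F y j)) * norm v"
      by (intro norm_linear_le linear_compose_sub lin)
    also have "\<dots> \<le> (\<Sum>j\<in>Basis. b j * norm (x - y)) * norm v"
      using lipschitz_onD[OF b x y] by (intro mult_right_mono sum_mono) (auto simp: dist_norm)
    also have "\<dots> \<le> B * norm (x - y) * norm v"
      unfolding sum_distrib_right[symmetric] by (intro mult_right_mono) (auto simp: B_def)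
    finally show "norm (field_map F x v - field_map F y v) \<le> B * norm (x - y) * norm v" .
  qed
qed

section \<open>Shooting in coordinate time\<close>

text \<open>With \<open>r\<close> the radial retraction onto the ball, Brouwer's theorem yields a
  fixed point of \<open>r (w - \<Phi> w)\<close>. If \<open>z = w - \<Phi> w\<close> lies in the
  ball, then \<open>\<Phi> w = 0\<close>. Otherwise \<open>w\<close> lies on the sphere and is a
  shortened multiple of \<open>z\<close>, which forces
  \<open>w \<bullet> \<Phi> w < 0\<close>.\<close>

lemma zero_of_outward_vector_field:
  fixes \<Phi> :: "'a::euclidean_space \<Rightarrow> 'a"
  assumes "R > 0" and cont: "continuous_on (cball 0 R) \<Phi>"
    and outward: "\<And>w. norm w = R \<Longrightarrow> w \<bullet> \<Phi> w \<ge> 0"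
  obtains w where "\<Phi> w = 0"
proof -
  define r where "r z = (R / max R (norm z)) *\<^sub>R z" for z :: 'a
  have "continuous_on (cball 0 R) (\<lambda>w. r (w - \<Phi> w))"
    unfolding r_def using \<open>R > 0\<close> by (auto intro!: continuous_intros cont)
  moreover have "norm (r z) \<le> R" for z
    unfolding r_def using \<open>R > 0\<close> by (auto simp: field_simps max_def)
  ultimately obtain w where w: "norm w \<le> R" "r (w - \<Phi> w) = w"
    using brouwer_ball[OF \<open>R > 0\<close>, of 0 "\<lambda>w. r (w - \<Phi> w)"] by auto
  define z where "z = w - \<Phi> w"
  have "\<Phi> w = 0"
  proof (cases "norm z \<le> R")
    case True
    then show ?thesis using w \<open>R > 0\<close> by (auto simp: r_def max_def z_def)
  next
    case False
    then have wz: "w = (R / norm z) *\<^sub>R z"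
      using w(2) by (simp add: r_def z_def[symmetric])
    have nw: "norm w = R"
      using False \<open>R > 0\<close> by (subst wz) auto
    have "w \<bullet> z = (R / norm z) * (norm z)\<^sup>2"
      by (subst wz) (simp add: power2_norm_eq_inner)
    also have "\<dots> = R * norm z" using False \<open>R > 0\<close> by (simp add: power2_eq_square)
    also have "\<dots> > R * R" using False \<open>R > 0\<close> by simp
    finally have "w \<bullet> z > w \<bullet> w" by (simp add: nw power2_eq_square flip: power2_norm_eq_inner)
    then have "w \<bullet> \<Phi> w < 0" by (simp add: z_def inner_diff_right)
    then show ?thesis using outward[OF nw] by simp
  qed
  then show ?thesis by (rule that)
qed

text \<open>The equations of motion with respect to coordinate time for the pair of the position and the
  four-momentum per mass; the force \<open>A\<close> is applied to the coordinate velocity.\<close>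

definition coordinate_time_system ::
  "(spacetime \<Rightarrow> spacetime \<Rightarrow> spacetime) \<Rightarrow> spacetime \<times> spacetime \<Rightarrow> spacetime \<times> spacetime"
where
  "coordinate_time_system A z = (direction (snd z), A (fst z) (direction (snd z)))"

text \<open>The position component contributes the 2, the Lipschitz constant of
  \<open>direction\<close>. The force contributes \<open>2 * B\<close> from moving the position, as
  directions have norm at most 2, and \<open>2 * B\<close> from changing the direction.\<close>

lemma coordinate_time_system_lipschitz:
  assumes lin: "\<And>x. linear (A x)" and "B \<ge> 0"
    and bound: "\<And>x v. norm (A x v) \<le> B * norm v"
    and lip: "\<And>x y v. norm (A x v - A y v) \<le> B * norm (x - y) * norm v"
  shows "(2 + 4 * B)-lipschitz_on UNIV (coordinate_time_system A)"
proof (rule lipschitz_onI)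
  fix z z' :: "spacetime \<times> spacetime"
  obtain x w y u where z: "z = (x, w)" "z' = (y, u)" by (cases z, cases z')
  define n where "n = norm (z - z')"
  have n: "norm (x - y) \<le> n" "norm (w - u) \<le> n" "n \<ge> 0"
    using norm_fst_le[of "x - y" "w - u"] norm_snd_le[of "w - u" "x - y"] by (auto simp: n_def z)
  have d: "norm (direction w - direction u) \<le> 2 * n"
    using direction_lipschitz[of w u] n by linarith
  have "A x (direction w) - A y (direction u)
      = (A x (direction w) - A y (direction w)) + A y (direction w - direction u)"
    using lin by (simp add: linear_diff)
  also have "norm \<dots> \<le> norm (A x (direction w) - A y (direction w)) + norm (A y (direction w - direction u))"
    by (rule norm_triangle_ineq)
  also have "norm (A x (direction w) - A y (direction w)) \<le> B * norm (x - y) * norm (direction w)"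
    by (rule lip)
  also have "\<dots> \<le> B * n * 2"
    using n \<open>B \<ge> 0\<close> norm_direction_le by (intro mult_mono) auto
  also have "norm (A y (direction w - direction u)) \<le> B * norm (direction w - direction u)"
    by (rule bound)
  also have "\<dots> \<le> B * (2 * n)"
    using \<open>B \<ge> 0\<close> d by (intro mult_left_mono) auto
  finally have "norm (A x (direction w) - A y (direction u)) \<le> 4 * B * n" by simp
  moreover have "norm (coordinate_time_system A z - coordinate_time_system A z')
      \<le> norm (direction w - direction u) + norm (A x (direction w) - A y (direction u))"
    unfolding coordinate_time_system_def z by (simp add: norm_Pair_le)
  ultimately show "dist (coordinate_time_system A z) (coordinate_time_system A z') \<le> (2 + 4 * B) * dist z z'"
    using d unfolding dist_norm n_def[symmetric] by (simp add: algebra_simps)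
qed (use \<open>B \<ge> 0\<close> in auto)

text \<open>Skewness of the force keeps the four-momentum on the mass shell, although time is not proper
  time: the rate of change of the energy is the power of the force.\<close>

lemma energy_conserved:
  assumes skew: "\<And>x v. minkowski v (A x v) = 0" and "0 \<le> L"
    and w: "\<And>t. t \<in> {0..L} \<Longrightarrow>
      (w has_vector_derivative A (x t) (direction (w t))) (at t within {0..L})"
  shows "w L $ 1 - energy (w L) = w 0 $ 1 - energy (w 0)"
proof (rule constant_within[OF \<open>0 \<le> L\<close>])
  fix t assume t: "t \<in> {0..L}"
  define a where "a = A (x t) (direction (w t))"
  have w': "(w has_vector_derivative a) (at t within {0..L})" using w[OF t] by (simp add: a_def)
  \<comment> \<open>This is the Minkowski product of the coordinate velocity with the force; the
    subtracted term will turn out to be the derivative of the energy.\<close>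
  have "a $ 1 - spatial (w t) \<bullet> spatial a / energy (w t) = 0"
    using skew[of "direction (w t)" "x t"]
    by (simp add: a_def[symmetric] minkowski_spatial spatial_direction divide_inverse mult.commute)
  moreover have "((\<lambda>s. w s $ 1) has_real_derivative a $ 1) (at t within {0..L})"
    unfolding has_real_derivative_iff_has_vector_derivative
    by (rule bounded_linear.has_vector_derivative[OF bounded_linear_vec_nth w'])
  moreover have "((\<lambda>s. energy (w s)) has_real_derivative
      (spatial (w t) \<bullet> spatial a / energy (w t))) (at t within {0..L})"
  proof -
    have s: "((\<lambda>s. spatial (w s)) has_vector_derivative spatial a) (at t within {0..L})"
      by (rule bounded_linear.has_vector_derivative[OF bounded_linear_spatial w'])
    have "((\<lambda>s. spatial (w s) \<bullet> spatial (w s)) has_real_derivative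
        2 * (spatial (w t) \<bullet> spatial a)) (at t within {0..L})"
      using bounded_bilinear.has_vector_derivative[OF bounded_bilinear_inner s s]
      by (simp add: has_real_derivative_iff_has_vector_derivative inner_commute)
    moreover have "1 + spatial (w t) \<bullet> spatial (w t) > 0"
      by (simp add: add_pos_nonneg)
    ultimately show ?thesis
      unfolding energy_eq by (auto intro!: derivative_eq_intros simp: divide_simps)
  qed
  ultimately show "((\<lambda>s. w s $ 1 - energy (w s)) has_real_derivative 0) (at t within {0..L})"
    using DERIV_diff by fastforce
qed

text \<open>The component of the velocity along \<open>p\<close> is
  \<open>p \<bullet> spatial (w t)\<close> over the energy. As the momentum stays within
  \<open>D\<close> of \<open>p\<close>, the numerator is at least
  \<open>norm p * (norm p - D)\<close> and the energy at most \<open>1 + norm p + D\<close>. For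
  large \<open>p\<close> the bound approaches \<open>L * norm p\<close>, the value for motion at the
  speed of light.\<close>

lemma displacement_lower_bound:
  assumes "0 \<le> L" "0 \<le> D"
    and x: "\<And>t. t \<in> {0..L} \<Longrightarrow> (x has_vector_derivative direction (w t)) (at t within {0..L})"
    and w: "\<And>t. t \<in> {0..L} \<Longrightarrow> norm (spatial (w t) - p) \<le> D"
    and p: "spatial p = p" "D \<le> norm p"
  shows "p \<bullet> (x L - x 0) \<ge> L * (norm p * (norm p - D) / (1 + norm p + D))"
proof -
  define c where "c = norm p * (norm p - D) / (1 + norm p + D)"
  have "p \<bullet> x 0 - c * 0 \<le> p \<bullet> x L - c * L"
  proof (rule nondecreasing_within[OF \<open>0 \<le> L\<close>])
    fix t assume t: "t \<in> {0..L}"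
    show "((\<lambda>t. p \<bullet> x t - c * t) has_real_derivative (p \<bullet> direction (w t) - c)) (at t within {0..L})"
      unfolding has_real_derivative_iff_has_vector_derivative
      by (auto intro!: derivative_eq_intros
          bounded_linear.has_vector_derivative[OF bounded_linear_inner_right x[OF t]])
    define d where "d = spatial (w t) - p"
    have d: "norm d \<le> D" using w[OF t] by (simp add: d_def)
    have "- (p \<bullet> d) \<le> norm p * norm d"
      using norm_cauchy_schwarz[of p "- d"] by simp
    also have "\<dots> \<le> norm p * D" using d by (intro mult_left_mono) auto
    finally have num: "norm p * (norm p - D) \<le> p \<bullet> spatial (w t)"
      by (simp add: d_def inner_diff_right algebra_simps power2_norm_eq_inner[symmetric] power2_eq_square)
    have "norm (spatial (w t)) \<le> norm p + norm d"
      using norm_triangle_ineq[of p d] by (simp add: d_def)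
    then have den: "energy (w t) \<le> 1 + norm p + D"
      using energy_le[of "w t"] d by linarith
    have "c \<le> (p \<bullet> spatial (w t)) / energy (w t)"
      unfolding c_def using num den energy_pos[of "w t"] p(2) \<open>0 \<le> D\<close>
      by (intro frac_le) (auto intro: order_trans[OF _ num])
    also have "\<dots> = p \<bullet> direction (w t)"
      using spatial_inner[of p "direction (w t)"] p(1)
      by (simp add: spatial_direction divide_inverse mult.commute)
    finally show "p \<bullet> direction (w t) - c \<ge> 0" by simp
  qed
  then show ?thesis by (simp add: c_def inner_diff_right mult.commute)
qed

text \<open>The bounds on \<open>A\<close> are global, so every initial momentum has a trajectory on
  all of \<open>{0..L}\<close> with an endpoint depending continuously on it; skewness keeps the
  trajectory on the mass shell.\<close>

lemma shooting:
  assumes lin: "\<And>x. linear (A x)" and "B \<ge> 0"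
    and bound: "\<And>x v. norm (A x v) \<le> B * norm v"
    and lip: "\<And>x y v. norm (A x v - A y v) \<le> B * norm (x - y) * norm v"
    and skew: "\<And>x v. minkowski v (A x v) = 0"
    and L: "L = (x1 - x0) $ 1" and chron: "norm (spatial (x1 - x0)) < L"
  obtains x w where "x 0 = x0" "x L = x1"
    and "\<And>t. t \<in> {0..L} \<Longrightarrow> (x has_vector_derivative direction (w t)) (at t within {0..L})"
    and "\<And>t. t \<in> {0..L} \<Longrightarrow> (w has_vector_derivative A (x t) (direction (w t))) (at t within {0..L})"
    and "\<And>t. t \<in> {0..L} \<Longrightarrow> w t $ 1 = energy (w t)"
proof -
  have "0 < L" using chron norm_ge_zero le_less_trans by blast
  define G where "G = coordinate_time_system A"
  define M where "M = 2 + 4 * B"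
  have G: "M-lipschitz_on UNIV G"
    unfolding G_def M_def by (rule coordinate_time_system_lipschitz[OF lin \<open>B \<ge> 0\<close> bound lip])
  \<comment> \<open>\<open>P W\<close> is the point of the future mass shell over the spatial
    momentum \<open>spatial W\<close>; it serves as initial four-momentum and ignores
    \<open>W $ 1\<close>.\<close>
  define P where "P W = spatial W + energy W *\<^sub>R axis 1 1" for W
  have P: "spatial (P W) = spatial W" "P W $ 1 = energy W" "energy (P W) = energy W" for W
    by (simp_all add: P_def spatial_add spatial_scaleR spatial_axis energy_eq)
  have "\<exists>Y. Y 0 = (x0, P W) \<and> (\<forall>t\<in>{0..L}. (Y has_vector_derivative G (Y t)) (at t within {0..L}))" for W
    using lipschitz_ode_exists[OF G \<open>0 < L\<close>, of "(x0, P W)"] by metis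
  then obtain Y where Y0: "\<And>W. Y W 0 = (x0, P W)"
    and Y: "\<And>W t. t \<in> {0..L} \<Longrightarrow> (Y W has_vector_derivative G (Y W t)) (at t within {0..L})"
    by metis
  define X where "X W t = fst (Y W t)" for W t
  define V where "V W t = snd (Y W t)" for W t
  have x0: "X W 0 = x0" and w0: "V W 0 = P W" for W
    by (simp_all add: X_def V_def Y0)
  have x: "(X W has_vector_derivative direction (V W t)) (at t within {0..L})" if "t \<in> {0..L}" for W t
    using bounded_linear.has_vector_derivative[OF bounded_linear_fst Y[OF that, of W]]
    by (simp add: X_def[abs_def] V_def G_def coordinate_time_system_def)
  have w: "(V W has_vector_derivative A (X W t) (direction (V W t))) (at t within {0..L})"
    if "t \<in> {0..L}" for W t
    using bounded_linear.has_vector_derivative[OF bounded_linear_snd Y[OF that, of W]]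
    by (simp add: X_def V_def[abs_def] G_def coordinate_time_system_def)
  have sub: "(f has_vector_derivative d) (at s within {0..t})"
    if "(f has_vector_derivative d) (at s within {0..L})" "t \<in> {0..L}"
    for f :: "real \<Rightarrow> spacetime" and d s t
    using that by (auto intro: has_vector_derivative_within_subset)
  have shell: "V W t $ 1 = energy (V W t)" if "t \<in> {0..L}" for W t
  proof -
    have "V W t $ 1 - energy (V W t) = V W 0 $ 1 - energy (V W 0)"
      using that by (intro energy_conserved[where A = A, OF skew, where w = "V W" and x = "X W"] sub[OF w]) auto
    then show ?thesis by (simp add: w0 P)
  qed
  \<comment> \<open>A force of norm at most \<open>2 * B\<close> acts for the time \<open>L\<close>,
    which bounds the change of momentum.\<close>
  define D where "D = 2 * B * L"
  have "D \<ge> 0" using \<open>B \<ge> 0\<close> \<open>0 < L\<close> by (simp add: D_def)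
  have wD: "norm (spatial (V W t) - spatial W) \<le> D" if "t \<in> {0..L}" for W t
  proof -
    have "norm (V W t - V W 0) \<le> (2 * B) * (t - 0)"
    proof (rule norm_diff_le_of_derivative)
      fix s assume s: "s \<in> {0..t}"
      show "(V W has_vector_derivative A (X W s) (direction (V W s))) (at s within {0..t})"
        using s that by (intro sub[OF w]) auto
      have "norm (A (X W s) (direction (V W s))) \<le> B * norm (direction (V W s))" by (rule bound)
      also have "\<dots> \<le> B * 2" using \<open>B \<ge> 0\<close> norm_direction_le by (intro mult_left_mono) auto
      finally show "norm (A (X W s) (direction (V W s))) \<le> 2 * B" by simp
    qed (use that in auto)
    also have "\<dots> \<le> D" unfolding D_def using that \<open>B \<ge> 0\<close> by (auto intro!: mult_left_mono)
    finally have "norm (spatial (V W t - V W 0)) \<le> D"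
      using norm_spatial_le order_trans by blast
    then show ?thesis by (simp add: spatial_diff w0 P)
  qed
  have time: "X W L $ 1 = x1 $ 1" for W
  proof -
    have "X W L $ 1 - L = X W 0 $ 1 - 0"
    proof (rule constant_within[where f = "\<lambda>t. X W t $ 1 - t"])
      fix t assume t: "t \<in> {0..L}"
      have "((\<lambda>t. X W t $ 1 - t) has_vector_derivative (direction (V W t) $ 1 - 1)) (at t within {0..L})"
        by (intro has_vector_derivative_diff has_vector_derivative_id
            bounded_linear.has_vector_derivative[OF bounded_linear_vec_nth x[OF t]])
      then show "((\<lambda>t. X W t $ 1 - t) has_real_derivative 0) (at t within {0..L})"
        by (simp add: has_real_derivative_iff_has_vector_derivative)
    qed (use \<open>0 < L\<close> in auto)
    then show ?thesis by (simp add: x0 L)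
  qed
  have far: "norm (X W L - x0) \<le> 2 * L" for W
  proof -
    have "norm (X W L - X W 0) \<le> 2 * (L - 0)"
      using \<open>0 < L\<close> by (intro norm_diff_le_of_derivative[OF _ x] norm_direction_le) auto
    then show ?thesis by (simp add: x0)
  qed
  have cont: "continuous_on S (\<lambda>W. X W L)" for S
  proof -
    \<comment> \<open>The exponential comes from the flow and the 2 from the Lipschitz constant of
      \<open>P\<close>.\<close>
    have "(exp (M * L) * 2)-lipschitz_on S (\<lambda>W. X W L)"
    proof (rule lipschitz_onI)
      fix W U
      have "norm (X W L - X U L) \<le> norm (Y W L - Y U L)"
        using norm_fst_le[of "fst (Y W L - Y U L)" "snd (Y W L - Y U L)"]
        unfolding prod.collapse by (simp add: X_def)
      also have "\<dots> \<le> exp (M * L) * norm (Y W 0 - Y U 0)"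
        using \<open>0 < L\<close> by (intro lipschitz_ode_dependence[OF G] Y) auto
      also have "norm (Y W 0 - Y U 0) = norm (P W - P U)" by (simp add: Y0 norm_Pair)
      also have "P W - P U = spatial (W - U) + (energy W - energy U) *\<^sub>R axis 1 1"
        by (simp add: P_def spatial_diff algebra_simps)
      also have "norm \<dots> \<le> norm (spatial (W - U)) + norm ((energy W - energy U) *\<^sub>R (axis 1 1 :: spacetime))"
        by (rule norm_triangle_ineq)
      also have "\<dots> \<le> 2 * norm (W - U)"
        using norm_spatial_le[of "W - U"] energy_lipschitz[of W U] by simp
      finally show "dist (X W L) (X U L) \<le> exp (M * L) * 2 * dist W U"
        by (simp add: dist_norm)
    qed simp
    then show ?thesis by (rule lipschitz_on_continuous_on)
  qed
  define \<Delta> where "\<Delta> = norm (spatial (x1 - x0))"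
  have \<Delta>: "0 \<le> \<Delta>" "\<Delta> < L" using chron by (simp_all add: \<Delta>_def)
  \<comment> \<open>For \<open>p \<ge> R1\<close> one has
    \<open>\<Delta> * (1 + p + D) \<le> L * (p - D)\<close>, which is what makes the bound of
    \<open>displacement_lower_bound\<close> at least \<open>p * \<Delta>\<close>. Such a threshold
    exists because \<open>\<Delta> < L\<close>.\<close>
  define R1 where "R1 = (L * D + \<Delta> * (1 + D)) / (L - \<Delta>)"
  define Q where "Q = 2 * L + norm (x1 - x0)"
  \<comment> \<open>\<open>Q\<close> bounds the error \<open>X W L - x1\<close>. Since
    \<open>R\<^sup>2 \<ge> R1\<^sup>2 + R1 * Q\<close>, a point of the sphere with spatial part
    shorter than \<open>R1\<close> has \<open>(W $ 1)\<^sup>2 \<ge> R1 * Q\<close>, enough to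
    outweigh a badly directed error.\<close>
  define R where "R = R1 + Q + 1"
  have "D \<le> R1"
    using \<Delta> \<open>D \<ge> 0\<close> by (simp add: R1_def field_simps)
  have pos: "R1 \<ge> 0" "Q \<ge> 0" "R > 0"
    using \<open>D \<le> R1\<close> \<open>D \<ge> 0\<close> \<open>0 < L\<close> norm_ge_zero[of "x1 - x0"]
    unfolding Q_def R_def by linarith+
  \<comment> \<open>Every trajectory ends at the time of \<open>x1\<close>, so the time component of the unknown is free; adding it
    to the error makes \<open>\<Phi>\<close> outward there, and only the spatial part of \<open>W\<close> matters.\<close>
  define \<Phi> where "\<Phi> W = (X W L - x1) + (W $ 1) *\<^sub>R axis 1 1" for W
  have inner_\<Phi>: "W \<bullet> \<Phi> W = (W $ 1)\<^sup>2 + spatial W \<bullet> (X W L - x1)" for W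
    using time[of W] by (simp add: \<Phi>_def inner_spacetime axis_def power2_eq_square)
  have "W \<bullet> \<Phi> W \<ge> 0" if "norm W = R" for W
  proof -
    define p where "p = norm (spatial W)"
    have "p \<ge> 0" by (simp add: p_def)
    show ?thesis
    proof (cases "R1 \<le> p")
      case True
      have "L * D + \<Delta> * (1 + D) \<le> p * (L - \<Delta>)"
        using True \<Delta> by (simp add: R1_def pos_divide_le_eq)
      then have "\<Delta> * (1 + p + D) \<le> L * (p - D)" by (simp add: algebra_simps)
      then have "\<Delta> \<le> L * (p - D) / (1 + p + D)"
        using \<open>p \<ge> 0\<close> \<open>D \<ge> 0\<close> by (simp add: pos_le_divide_eq)
      then have "p * \<Delta> \<le> p * (L * (p - D) / (1 + p + D))"
        using \<open>p \<ge> 0\<close> by (rule mult_left_mono)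
      also have "\<dots> = L * (p * (p - D) / (1 + p + D))" by simp
      also have "\<dots> \<le> spatial W \<bullet> (X W L - X W 0)"
        unfolding p_def using \<open>0 < L\<close> \<open>D \<ge> 0\<close> True \<open>D \<le> R1\<close>
        by (intro displacement_lower_bound[OF _ _ x wD]) (auto simp: p_def)
      finally have 1: "p * \<Delta> \<le> spatial W \<bullet> (X W L - x0)" by (simp add: x0)
      have 2: "spatial W \<bullet> (x1 - x0) \<le> p * \<Delta>"
        unfolding p_def \<Delta>_def spatial_inner[of W "x1 - x0"] by (rule norm_cauchy_schwarz)
      have "spatial W \<bullet> (X W L - x1) = spatial W \<bullet> (X W L - x0) - spatial W \<bullet> (x1 - x0)"
        by (simp add: inner_diff_right)
      with 1 2 have "spatial W \<bullet> (X W L - x1) \<ge> 0" by linarith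
      then show ?thesis by (simp add: inner_\<Phi>)
    next
      case False
      have "norm (X W L - x1) \<le> norm (X W L - x0) + norm (x1 - x0)"
        using norm_triangle_ineq4[of "X W L - x0" "x1 - x0"] by simp
      also have "\<dots> \<le> Q" using far[of W] by (simp add: Q_def)
      finally have "p * norm (X W L - x1) \<le> R1 * Q"
        using False \<open>p \<ge> 0\<close> by (intro mult_mono) auto
      then have a: "spatial W \<bullet> (X W L - x1) \<ge> - (R1 * Q)"
        using norm_cauchy_schwarz[of "spatial W" "- (X W L - x1)"]
        by (simp add: p_def inner_diff_right norm_minus_commute)
      have "p\<^sup>2 \<le> R1\<^sup>2" using False \<open>p \<ge> 0\<close> by (intro power_mono) auto
      moreover have "R\<^sup>2 = (W $ 1)\<^sup>2 + p\<^sup>2"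
        using norm_spatial[of W] that by (simp add: p_def)
      moreover have "R\<^sup>2 \<ge> R1\<^sup>2 + R1 * Q"
        using pos by (simp add: R_def power2_eq_square algebra_simps)
      ultimately show ?thesis using a by (simp add: inner_\<Phi>)
    qed
  qed
  moreover have "continuous_on (cball 0 R) \<Phi>"
    unfolding \<Phi>_def by (auto intro!: continuous_intros cont)
  ultimately obtain W where W: "\<Phi> W = 0"
    using zero_of_outward_vector_field[OF \<open>R > 0\<close>] by metis
  \<comment> \<open>The time component of \<open>\<Phi> W\<close> is \<open>W $ 1\<close>, so at a
    zero the added term disappears and the error itself vanishes.\<close>
  then have "\<Phi> W $ 1 = 0" by simp
  then have "W $ 1 = 0" using time[of W] by (simp add: \<Phi>_def)
  then have "X W L = x1" using W by (simp add: \<Phi>_def)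
  then show ?thesis
    using that[of "X W" "V W"] x0 x w shell by auto
qed

section \<open>Proper time\<close>

text \<open>Proper time is introduced by solving \<open>dt/ds = energy\<close> for the coordinate time \<open>t\<close>; as
  \<open>dt/ds \<ge> 1\<close>, the whole coordinate time interval is exhausted.\<close>

lemma proper_time_change:
  assumes "0 < L"
    and w: "\<And>t. t \<in> {0..L} \<Longrightarrow> (w has_vector_derivative w' t) (at t within {0..L})"
    and B: "\<And>t. t \<in> {0..L} \<Longrightarrow> norm (w' t) \<le> B"
  obtains \<tau> T where "0 < T" "\<tau> 0 = 0" "\<tau> T = L" "\<tau> ` {0..T} \<subseteq> {0..L}"
    and "\<And>s. s \<in> {0..T} \<Longrightarrow> (\<tau> has_vector_derivative energy (w (\<tau> s))) (at s within {0..T})"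
proof -
  \<comment> \<open>As \<open>w\<close> is controlled only on \<open>{0..L}\<close>, clamping its
    argument makes the right-hand side globally Lipschitz, as \<open>lipschitz_ode_exists\<close>
    requires.\<close>
  define h where "h t = energy (w (clamp 0 L t))" for t :: real
  have cl: "clamp 0 L t \<in> {0..L}" for t
    using clamp_in_interval[of 0 L t] \<open>0 < L\<close> by auto
  have "B \<ge> 0" using order_trans[OF norm_ge_zero B[of 0]] \<open>0 < L\<close> by auto
  have wl: "norm (w t - w s) \<le> B * (t - s)" if "0 \<le> s" "s \<le> t" "t \<le> L" for s t
  proof (rule norm_diff_le_of_derivative[OF \<open>s \<le> t\<close>])
    fix r assume "r \<in> {s..t}"
    then show "(w has_vector_derivative w' r) (at r within {s..t})" "norm (w' r) \<le> B"
      using that by (auto intro: has_vector_derivative_within_subset[OF w] B)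
  qed
  have "B-lipschitz_on UNIV h"
  proof (rule lipschitz_onI)
    fix t s :: real
    define a where "a = clamp 0 L t"
    define b where "b = clamp 0 L s"
    have "\<bar>h t - h s\<bar> \<le> norm (w a - w b)"
      unfolding h_def a_def b_def by (rule energy_lipschitz)
    also have "\<dots> \<le> B * \<bar>a - b\<bar>"
    proof (cases "b \<le> a")
      case True
      then show ?thesis using wl[of b a] cl[of t] cl[of s] by (simp add: a_def b_def)
    next
      case False
      then show ?thesis using wl[of a b] cl[of t] cl[of s] by (simp add: a_def b_def norm_minus_commute)
    qed
    also have "\<dots> \<le> B * \<bar>t - s\<bar>"
      using \<open>B \<ge> 0\<close> dist_clamps_le_dist_args[of 0 L t s]
      by (intro mult_left_mono) (auto simp: a_def b_def dist_real_def)
    finally show "dist (h t) (h s) \<le> B * dist t s" by (simp add: dist_real_def)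
  qed (rule \<open>B \<ge> 0\<close>)
  then obtain \<tau> where \<tau>0: "\<tau> 0 = 0"
    and \<tau>: "\<And>s. s \<in> {0..L} \<Longrightarrow> (\<tau> has_vector_derivative h (\<tau> s)) (at s within {0..L})"
    using lipschitz_ode_exists[OF _ \<open>0 < L\<close>] by metis
  have h1: "h t \<ge> 1" for t unfolding h_def by (rule energy_ge_1)
  have mono: "b - a \<le> \<tau> b - \<tau> a" if "0 \<le> a" "a \<le> b" "b \<le> L" for a b
  proof -
    have "\<tau> a - a \<le> \<tau> b - b"
    proof (rule nondecreasing_within[OF \<open>a \<le> b\<close>])
      fix s assume s: "s \<in> {a..b}"
      have "(\<tau> has_vector_derivative h (\<tau> s)) (at s within {a..b})"
        using s that by (auto intro: has_vector_derivative_within_subset[OF \<tau>])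
      then show "((\<lambda>s. \<tau> s - s) has_real_derivative (h (\<tau> s) - 1)) (at s within {a..b})"
        unfolding has_real_derivative_iff_has_vector_derivative
        by (intro has_vector_derivative_diff has_vector_derivative_id)
      show "h (\<tau> s) - 1 \<ge> 0" using h1[of "\<tau> s"] by simp
    qed
    then show ?thesis by simp
  qed
  have "continuous_on {0..L} \<tau>"
    using \<tau> by (intro differentiable_imp_continuous_on)
      (unfold differentiable_on_def, blast intro: differentiableI_vector)
  \<comment> \<open>Since \<open>\<tau>\<close> grows at least at unit rate, it reaches
    \<open>L\<close> no later than at the parameter \<open>L\<close>. Up to \<open>T\<close> its
    values stay in \<open>{0..L}\<close>, where the clamping has no effect.\<close>
  then obtain T where T: "0 \<le> T" "T \<le> L" "\<tau> T = L"
    using IVT'[of \<tau> 0 L L] mono[of 0 L] \<open>0 < L\<close> by (auto simp: \<tau>0)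
  have range: "\<tau> s \<in> {0..L}" if "s \<in> {0..T}" for s
    using mono[of 0 s] mono[of s T] that T by (auto simp: \<tau>0)
  show ?thesis
  proof
    show "0 < T" using T \<tau>0 \<open>0 < L\<close> by (cases "T = 0") auto
    show "\<tau> ` {0..T} \<subseteq> {0..L}" using range by auto
    fix s assume s: "s \<in> {0..T}"
    have "(\<tau> has_vector_derivative h (\<tau> s)) (at s within {0..T})"
      using s T by (auto intro: has_vector_derivative_within_subset[OF \<tau>])
    then show "(\<tau> has_vector_derivative energy (w (\<tau> s))) (at s within {0..T})"
      using range[OF s] by (simp add: h_def)
  qed (use \<tau>0 T in auto)
qed

theorem corollary2p5:
  fixes c charge_mass_ratio :: real
    and F :: "spacetime \<Rightarrow> spacetime \<Rightarrow> spacetime \<Rightarrow> real"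
    and x0 x1 :: spacetime
  assumes "c > 0"
    and "closed_two_form F"
    and "x1 \<in> chronological_future x0"
  shows "\<exists>\<gamma> a b. future_timelike_curve \<gamma> a b \<and> connects \<gamma> a b x0 x1 \<and>
           proper_time_parameterized \<gamma> a b \<and>
           lorentz_force_solution (charge_mass_ratio / c\<^sup>2) F \<gamma> a b"
proof -
  define k where "k = charge_mass_ratio / c\<^sup>2"
  have F: "two_form F" using assms(2) by (simp add: closed_two_form_def)
  have lin: "linear (field_map F x)" and map: "minkowski v (field_map F x w) = F x v w" for x v w
    using field_map[OF F] by blast+
  define L where "L = (x1 - x0) $ 1"
  have chron: "norm (spatial (x1 - x0)) < L"
    unfolding L_def by (rule chronological_future_imp[OF assms(3)])
  then have "0 < L" using norm_ge_zero le_less_trans by blast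
  \<comment> \<open>The field is cut off outside \<open>K\<close>, which no trajectory leaves: \<open>norm_direction_le\<close>.\<close>
  define K where "K = cball x0 (2 * L)"
  have K: "compact K" "convex K" "closed K" "K \<noteq> {}"
    using \<open>0 < L\<close> by (auto simp: K_def)
  obtain B where B: "B \<ge> 0"
    and bound: "\<And>x v. x \<in> K \<Longrightarrow> norm (field_map F x v) \<le> B * norm v"
    and lip: "\<And>x y v. x \<in> K \<Longrightarrow> y \<in> K \<Longrightarrow>
           norm (field_map F x v - field_map F y v) \<le> B * norm (x - y) * norm v"
    using field_map_bounds[OF F K(1,2)] by blast
  \<comment> \<open>The nearest-point projection onto a convex set does not increase distances, so
    extending the field by its values at \<open>\<rho> x\<close> preserves both bounds.\<close>
  define \<rho> where "\<rho> = closest_point K"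
  have \<rho>: "\<rho> x \<in> K" "norm (\<rho> x - \<rho> y) \<le> norm (x - y)" for x y
    unfolding \<rho>_def using closest_point_in_set[OF K(3,4)] closest_point_lipschitz[OF K(2,3,4)]
    by (auto simp: dist_norm)
  define A where "A x v = k *\<^sub>R field_map F (\<rho> x) v" for x v
  define C where "C = \<bar>k\<bar> * B"
  have "C \<ge> 0" using B by (simp add: C_def)
  have Alin: "linear (A x)" for x
    unfolding A_def by (intro linear_compose_scale_right lin)
  have Abound: "norm (A x v) \<le> C * norm v" for x v
    using mult_left_mono[OF bound[OF \<rho>(1)[of x], of v], of "\<bar>k\<bar>"] by (simp add: A_def C_def mult.assoc)
  have Alip: "norm (A x v - A y v) \<le> C * norm (x - y) * norm v" for x y v
  proof -
    have "norm (A x v - A y v) = \<bar>k\<bar> * norm (field_map F (\<rho> x) v - field_map F (\<rho> y) v)"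
      by (simp add: A_def flip: scaleR_diff_right)
    also have "\<dots> \<le> \<bar>k\<bar> * (B * norm (\<rho> x - \<rho> y) * norm v)"
      by (intro mult_left_mono lip \<rho>) auto
    also have "\<dots> \<le> \<bar>k\<bar> * (B * norm (x - y) * norm v)"
      using B by (intro mult_left_mono mult_right_mono \<rho>) auto
    finally show ?thesis by (simp add: C_def mult.assoc)
  qed
  have Askew: "minkowski v (A x v) = 0" for x v
  proof -
    have "minkowski v (A x v) = k * minkowski v (field_map F (\<rho> x) v)"
      by (simp add: A_def minkowski_def algebra_simps)
    then show ?thesis using F by (simp add: map two_form_def)
  qed
  obtain x w where x0: "x 0 = x0" and x1: "x L = x1"
    and x: "\<And>t. t \<in> {0..L} \<Longrightarrow> (x has_vector_derivative direction (w t)) (at t within {0..L})"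
    and w: "\<And>t. t \<in> {0..L} \<Longrightarrow> (w has_vector_derivative A (x t) (direction (w t))) (at t within {0..L})"
    and shell: "\<And>t. t \<in> {0..L} \<Longrightarrow> w t $ 1 = energy (w t)"
    using shooting[OF Alin \<open>C \<ge> 0\<close> Abound Alip Askew L_def chron] by metis
  have xK: "x t \<in> K" if "t \<in> {0..L}" for t
  proof -
    have "norm (x t - x 0) \<le> 2 * (t - 0)"
      using that by (intro norm_diff_le_of_derivative[where f' = "\<lambda>s. direction (w s)"] norm_direction_le)
        (auto intro: has_vector_derivative_within_subset[OF x])
    then show ?thesis using that by (simp add: K_def x0 dist_norm norm_minus_commute)
  qed
  have "norm (A (x t) (direction (w t))) \<le> C * 2" for t
    using Abound[of "x t" "direction (w t)"] mult_left_mono[OF norm_direction_le \<open>C \<ge> 0\<close>] order_trans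
    by blast
  then obtain \<tau> T where T: "0 < T" "\<tau> 0 = 0" "\<tau> T = L" "\<tau> ` {0..T} \<subseteq> {0..L}"
    and \<tau>: "\<And>s. s \<in> {0..T} \<Longrightarrow> (\<tau> has_vector_derivative energy (w (\<tau> s))) (at s within {0..T})"
    using proper_time_change[OF \<open>0 < L\<close> w] by metis
  define \<gamma> where "\<gamma> = x \<circ> \<tau>"
  define u where "u = w \<circ> \<tau>"
  \<comment> \<open>On the mass shell the factor \<open>dt/ds\<close> turns the coordinate velocity
    into the four-momentum per mass, which is thus the proper-time velocity. Linearity of
    \<open>A\<close> absorbs the same factor in the force.\<close>
  have energy_direction: "energy (w t) *\<^sub>R direction (w t) = w t" if "t \<in> {0..L}" for t
    using shell[OF that] energy_pos[of "w t"]
    by (simp add: direction_def scaleR_right_distrib) (simp add: spatial_def)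
  have \<gamma>: "(\<gamma> has_vector_derivative u s) (at s within {0..T})"
    and u: "(u has_vector_derivative k *\<^sub>R field_map F (\<gamma> s) (u s)) (at s within {0..T})"
    if s: "s \<in> {0..T}" for s
  proof -
    have t: "\<tau> s \<in> {0..L}" using T(4) s by blast
    have "(\<gamma> has_vector_derivative energy (w (\<tau> s)) *\<^sub>R direction (w (\<tau> s))) (at s within {0..T})"
      unfolding \<gamma>_def
      by (rule vector_diff_chain_within[OF \<tau>[OF s] has_vector_derivative_within_subset[OF x[OF t] T(4)]])
    then show "(\<gamma> has_vector_derivative u s) (at s within {0..T})"
      by (simp add: energy_direction[OF t] u_def)
    have "(u has_vector_derivative energy (w (\<tau> s)) *\<^sub>R A (x (\<tau> s)) (direction (w (\<tau> s))))
        (at s within {0..T})"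
      unfolding u_def
      by (rule vector_diff_chain_within[OF \<tau>[OF s] has_vector_derivative_within_subset[OF w[OF t] T(4)]])
    also have "energy (w (\<tau> s)) *\<^sub>R A (x (\<tau> s)) (direction (w (\<tau> s)))
        = A (x (\<tau> s)) (energy (w (\<tau> s)) *\<^sub>R direction (w (\<tau> s)))"
      using Alin by (simp add: linear_cmul)
    also have "\<dots> = k *\<^sub>R field_map F (\<gamma> s) (u s)"
      using closest_point_self[OF xK[OF t]]
      by (simp add: energy_direction[OF t] A_def \<rho>_def \<gamma>_def u_def)
    finally show "(u has_vector_derivative k *\<^sub>R field_map F (\<gamma> s) (u s)) (at s within {0..T})" .
  qed
  have vel: "velocity \<gamma> 0 T s = u s" if "s \<in> {0..T}" for s
    unfolding velocity_def using vector_derivative_within_closed_interval[OF T(1) that \<gamma>[OF that]] .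
  have deriv_vel: "(velocity \<gamma> 0 T has_vector_derivative k *\<^sub>R field_map F (\<gamma> s) (u s)) (at s within {0..T})"
    if "s \<in> {0..T}" for s
    using u[OF that] by (rule has_vector_derivative_transform[OF that, rotated]) (simp add: vel)
  have unit: "minkowski (u s) (u s) = 1" and future: "u s $ 1 > 0" if "s \<in> {0..T}" for s
  proof -
    have "\<tau> s \<in> {0..L}" using T(4) that by blast
    then have "u s $ 1 = energy (u s)" using shell by (simp add: u_def)
    moreover have "(energy (u s))\<^sup>2 = 1 + spatial (u s) \<bullet> spatial (u s)"
      unfolding energy_eq by (rule real_sqrt_pow2) simp
    ultimately show "minkowski (u s) (u s) = 1" "u s $ 1 > 0"
      using energy_pos[of "u s"] by (simp_all add: minkowski_spatial power2_eq_square)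
  qed
  have "C1_curve \<gamma> 0 T"
    unfolding C1_curve_def
  proof (intro conjI)
    show "\<gamma> differentiable_on {0..T}"
      unfolding differentiable_on_def using \<gamma> by (blast intro: differentiableI_vector)
    show "continuous_on {0..T} (velocity \<gamma> 0 T)"
      using deriv_vel by (intro differentiable_imp_continuous_on)
        (unfold differentiable_on_def, blast intro: differentiableI_vector)
  qed (rule T(1))
  then have "future_timelike_curve \<gamma> 0 T"
    using unit future by (simp add: future_timelike_curve_def timelike_def future_directed_def vel)
  moreover have "connects \<gamma> 0 T x0 x1"
    using T x0 x1 by (simp add: connects_def \<gamma>_def)
  moreover have "proper_time_parameterized \<gamma> 0 T"
    using unit by (simp add: proper_time_parameterized_def vel)
  moreover have "lorentz_force_solution (charge_mass_ratio / c\<^sup>2) F \<gamma> 0 T"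
    using deriv_vel by (simp add: lorentz_force_solution_def vel k_def[symmetric])
  ultimately show ?thesis by blast
qed

end
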